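(* Let $S(X)$ be the free Steiner loop with a finite set $X=\{x_1,\dots,x_n\}$ of free generators. Then $\mathrm{Aut}(S(X))=\mathrm{T}(X)$; that is, every automorphism of $S(X)$ is tame.
   Context: A Steiner loop is a commutative loop with identity $e$ satisfying $x\cdot x=e$ and $x\cdot(x\cdot y)=y$ for all $x,y$ (equivalently, a diassociative loop of exponent $2$). Steiner loops form a variety, and free objects are taken in this variety. For $i\in\{1,\dots,n\}$ and $v\in S(X\setminus\{x_i\})$ (the subloop generated by $X\setminus\{x_i\}$), the $X$-elementary automorphism $e_i(v)$ is the automorphism of $S(X)$ determined by $x_i\mapsto x_i\cdot v$ and $x_j\mapsto x_j$ for $j\neq i$. $\mathrm{T}(X)$ denotes the subgroup of $\mathrm{Aut}(S(X))$ generated by all $X$-elementary automorphisms; its elements are called tame. *)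

theory Defs
  imports "HOL-Algebra.Bij" "HOL-Algebra.Generated_Groups"
begin

section \<open>Loops and Steiner loops\<close>

text \<open>
  The record \<^type>\<open>monoid_ext\<close> supplies only the signature (carrier, product, identity);
  associativity is never assumed.
\<close>

locale loop =
  fixes L (structure)
  assumes m_closed: "\<lbrakk>x \<in> carrier L; y \<in> carrier L\<rbrakk> \<Longrightarrow> x \<otimes> y \<in> carrier L"
    and one_closed: "\<one> \<in> carrier L"
    and l_one: "x \<in> carrier L \<Longrightarrow> \<one> \<otimes> x = x"
    and r_one: "x \<in> carrier L \<Longrightarrow> x \<otimes> \<one> = x"
    and l_div: "\<lbrakk>a \<in> carrier L; b \<in> carrier L\<rbrakk> \<Longrightarrow> \<exists>!x. x \<in> carrier L \<and> a \<otimes> x = b"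
    and r_div: "\<lbrakk>a \<in> carrier L; b \<in> carrier L\<rbrakk> \<Longrightarrow> \<exists>!y. y \<in> carrier L \<and> y \<otimes> a = b"

locale steiner_loop = loop +
  assumes comm: "\<lbrakk>x \<in> carrier L; y \<in> carrier L\<rbrakk> \<Longrightarrow> x \<otimes> y = y \<otimes> x"
    and square: "x \<in> carrier L \<Longrightarrow> x \<otimes> x = \<one>"
    and cancel: "\<lbrakk>x \<in> carrier L; y \<in> carrier L\<rbrakk> \<Longrightarrow> x \<otimes> (x \<otimes> y) = y"

text \<open>The division axioms are redundant for Steiner loops: they form the variety in the signature
  (product, identity) given by the following identities.\<close>

lemma steiner_loopI:
  fixes L (structure)
  assumes m_closed: "\<And>x y. \<lbrakk>x \<in> carrier L; y \<in> carrier L\<rbrakk> \<Longrightarrow> x \<otimes> y \<in> carrier L"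
    and one_closed: "\<one> \<in> carrier L"
    and l_one: "\<And>x. x \<in> carrier L \<Longrightarrow> \<one> \<otimes> x = x"
    and comm: "\<And>x y. \<lbrakk>x \<in> carrier L; y \<in> carrier L\<rbrakk> \<Longrightarrow> x \<otimes> y = y \<otimes> x"
    and square: "\<And>x. x \<in> carrier L \<Longrightarrow> x \<otimes> x = \<one>"
    and cancel: "\<And>x y. \<lbrakk>x \<in> carrier L; y \<in> carrier L\<rbrakk> \<Longrightarrow> x \<otimes> (x \<otimes> y) = y"
  shows "steiner_loop L"
proof
  fix a b assume ab: "a \<in> carrier L" "b \<in> carrier L"
  show "\<exists>!x. x \<in> carrier L \<and> a \<otimes> x = b"
    by (rule ex1I[of _ "a \<otimes> b"]) (use ab m_closed cancel in auto)
  then show "\<exists>!y. y \<in> carrier L \<and> y \<otimes> a = b"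
    using ab comm by metis
next
  fix x assume "x \<in> carrier L"
  then show "x \<otimes> \<one> = x" using comm one_closed l_one by metis
qed (use assms in auto)

definition subloop :: "'a set \<Rightarrow> ('a, 'b) monoid_scheme \<Rightarrow> bool"
  where "subloop H L \<longleftrightarrow> H \<subseteq> carrier L \<and> loop (L\<lparr>carrier := H\<rparr>)"

definition subloop_generated :: "('a, 'b) monoid_scheme \<Rightarrow> 'a set \<Rightarrow> 'a set"
  where "subloop_generated L A = \<Inter>{H. subloop H L \<and> A \<subseteq> H}"

section \<open>Free Steiner loops\<close>

datatype 'a loop_term = Var 'a | Unit | Prod "'a loop_term" "'a loop_term"

inductive_set terms :: "'a set \<Rightarrow> 'a loop_term set" for X
  where
    Var: "x \<in> X \<Longrightarrow> Var x \<in> terms X"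
  | Unit: "Unit \<in> terms X"
  | Prod: "\<lbrakk>s \<in> terms X; t \<in> terms X\<rbrakk> \<Longrightarrow> Prod s t \<in> terms X"

text \<open>The equational theory of Steiner loops, as a congruence on the terms over \<open>X\<close>.\<close>

inductive_set steiner_cong :: "'a set \<Rightarrow> ('a loop_term \<times> 'a loop_term) set" for X
  where
    refl: "t \<in> terms X \<Longrightarrow> (t, t) \<in> steiner_cong X"
  | sym: "(s, t) \<in> steiner_cong X \<Longrightarrow> (t, s) \<in> steiner_cong X"
  | trans: "\<lbrakk>(s, t) \<in> steiner_cong X; (t, u) \<in> steiner_cong X\<rbrakk> \<Longrightarrow> (s, u) \<in> steiner_cong X"
  | prod: "\<lbrakk>(s, s') \<in> steiner_cong X; (t, t') \<in> steiner_cong X\<rbrakk>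
      \<Longrightarrow> (Prod s t, Prod s' t') \<in> steiner_cong X"
  | unit: "t \<in> terms X \<Longrightarrow> (Prod Unit t, t) \<in> steiner_cong X"
  | comm: "\<lbrakk>s \<in> terms X; t \<in> terms X\<rbrakk> \<Longrightarrow> (Prod s t, Prod t s) \<in> steiner_cong X"
  | square: "t \<in> terms X \<Longrightarrow> (Prod t t, Unit) \<in> steiner_cong X"
  | cancel: "\<lbrakk>s \<in> terms X; t \<in> terms X\<rbrakk> \<Longrightarrow> (Prod s (Prod s t), t) \<in> steiner_cong X"

definition free_steiner_loop :: "'a set \<Rightarrow> 'a loop_term set monoid"
  where "free_steiner_loop X =
    \<lparr>carrier = terms X // steiner_cong X,
     mult = \<lambda>A B. \<Union>s\<in>A. \<Union>t\<in>B. steiner_cong X `` {Prod s t},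
     one = steiner_cong X `` {Unit}\<rparr>"

definition free_gen :: "'a set \<Rightarrow> 'a \<Rightarrow> 'a loop_term set"
  where "free_gen X x = steiner_cong X `` {Var x}"

subsection \<open>The universal property\<close>

lemma steiner_cong_terms:
  "(s, t) \<in> steiner_cong X \<Longrightarrow> s \<in> terms X \<and> t \<in> terms X"
  by (induction rule: steiner_cong.induct) (auto intro: terms.intros)

lemma equiv_steiner_cong: "equiv (terms X) (steiner_cong X)"
proof (rule equivI)
  show "steiner_cong X \<subseteq> terms X \<times> terms X"
    using steiner_cong_terms by auto
  show "refl_on (terms X) (steiner_cong X)"
    by (simp add: refl_on_def steiner_cong.refl)
  show "sym (steiner_cong X)"
    by (rule symI) (rule steiner_cong.sym)
  show "trans (steiner_cong X)"
    by (rule transI) (rule steiner_cong.trans)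
qed

lemma free_carrier_iff:
  "A \<in> carrier (free_steiner_loop X) \<longleftrightarrow> (\<exists>t\<in>terms X. A = steiner_cong X `` {t})"
  by (auto simp: free_steiner_loop_def quotient_def)

lemma free_one: "\<one>\<^bsub>free_steiner_loop X\<^esub> = steiner_cong X `` {Unit}"
  by (simp add: free_steiner_loop_def)

lemma free_mult:
  assumes "s \<in> terms X" "t \<in> terms X"
  shows "steiner_cong X `` {s} \<otimes>\<^bsub>free_steiner_loop X\<^esub> steiner_cong X `` {t}
    = steiner_cong X `` {Prod s t}"
proof -
  have eq: "steiner_cong X `` {Prod s' t'} = steiner_cong X `` {Prod s t}"
    if "s' \<in> steiner_cong X `` {s}" "t' \<in> steiner_cong X `` {t}" for s' t'
  proof (rule equiv_class_eq[OF equiv_steiner_cong])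
    have "(s, s') \<in> steiner_cong X" "(t, t') \<in> steiner_cong X" using that by auto
    then show "(Prod s' t', Prod s t) \<in> steiner_cong X"
      by (rule steiner_cong.sym[OF steiner_cong.prod])
  qed
  have st: "s \<in> steiner_cong X `` {s}" "t \<in> steiner_cong X `` {t}"
    using steiner_cong.refl[OF assms(1)] steiner_cong.refl[OF assms(2)] by auto
  have "(\<Union>s'\<in>steiner_cong X `` {s}. \<Union>t'\<in>steiner_cong X `` {t}. steiner_cong X `` {Prod s' t'})
      = (\<Union>s'\<in>steiner_cong X `` {s}. \<Union>t'\<in>steiner_cong X `` {t}. steiner_cong X `` {Prod s t})"
    by (intro SUP_cong HOL.refl eq)
  also have "\<dots> = steiner_cong X `` {Prod s t}"
    using st by blast
  finally show ?thesis by (simp add: free_steiner_loop_def)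
qed

lemma free_class_eq: "(s, t) \<in> steiner_cong X \<Longrightarrow> steiner_cong X `` {s} = steiner_cong X `` {t}"
  by (rule equiv_class_eq[OF equiv_steiner_cong])

lemma steiner_loop_free: "steiner_loop (free_steiner_loop X)"
proof (rule steiner_loopI)
  fix A B assume "A \<in> carrier (free_steiner_loop X)" "B \<in> carrier (free_steiner_loop X)"
  then obtain s t where st: "s \<in> terms X" "t \<in> terms X"
    "A = steiner_cong X `` {s}" "B = steiner_cong X `` {t}"
    by (auto simp: free_carrier_iff)
  show "A \<otimes>\<^bsub>free_steiner_loop X\<^esub> B \<in> carrier (free_steiner_loop X)"
    using st by (auto simp: free_mult free_carrier_iff intro: terms.intros)
  show "A \<otimes>\<^bsub>free_steiner_loop X\<^esub> B = B \<otimes>\<^bsub>free_steiner_loop X\<^esub> A"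
    using st by (simp add: free_mult free_class_eq[OF steiner_cong.comm])
  show "A \<otimes>\<^bsub>free_steiner_loop X\<^esub> (A \<otimes>\<^bsub>free_steiner_loop X\<^esub> B) = B"
    using st by (simp add: free_mult terms.Prod free_class_eq[OF steiner_cong.cancel])
  show "A \<otimes>\<^bsub>free_steiner_loop X\<^esub> A = \<one>\<^bsub>free_steiner_loop X\<^esub>"
    using st by (simp add: free_mult free_one free_class_eq[OF steiner_cong.square])
  show "\<one>\<^bsub>free_steiner_loop X\<^esub> \<otimes>\<^bsub>free_steiner_loop X\<^esub> A = A"
    using st by (simp add: free_mult free_one terms.Unit free_class_eq[OF steiner_cong.unit])
next
  show "\<one>\<^bsub>free_steiner_loop X\<^esub> \<in> carrier (free_steiner_loop X)"
    by (auto simp: free_one free_carrier_iff intro: terms.Unit)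
qed

lemma free_gen_closed: "x \<in> X \<Longrightarrow> free_gen X x \<in> carrier (free_steiner_loop X)"
  by (auto simp: free_gen_def free_carrier_iff intro: terms.Var)

primrec eval_term :: "('b, 'c) monoid_scheme \<Rightarrow> ('a \<Rightarrow> 'b) \<Rightarrow> 'a loop_term \<Rightarrow> 'b"
  where
    "eval_term M f (Var x) = f x"
  | "eval_term M f Unit = \<one>\<^bsub>M\<^esub>"
  | "eval_term M f (Prod s t) = eval_term M f s \<otimes>\<^bsub>M\<^esub> eval_term M f t"

lemma eval_term_closed:
  assumes "steiner_loop M" "f \<in> X \<rightarrow> carrier M" "t \<in> terms X"
  shows "eval_term M f t \<in> carrier M"
proof -
  interpret M: steiner_loop M by fact
  show ?thesis using assms(3)
    by induction (use assms(2) M.m_closed M.one_closed in auto)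
qed

lemma eval_term_cong:
  assumes "steiner_loop M" "f \<in> X \<rightarrow> carrier M" "(s, t) \<in> steiner_cong X"
  shows "eval_term M f s = eval_term M f t"
proof -
  interpret M: steiner_loop M by fact
  note cl = eval_term_closed[OF assms(1,2)]
  show ?thesis using assms(3)
  proof induction
    case (comm s t)
    then show ?case by (simp add: M.comm[OF cl cl])
  qed (simp_all add: cl M.l_one M.square M.cancel)
qed

text \<open>A homomorphism out of a Steiner loop automatically preserves the identity.\<close>

lemma hom_one:
  assumes "steiner_loop L" "steiner_loop M" "h \<in> hom L M"
  shows "h \<one>\<^bsub>L\<^esub> = \<one>\<^bsub>M\<^esub>"
proof -
  interpret L: steiner_loop L by fact
  interpret M: steiner_loop M by fact
  have "h (\<one>\<^bsub>L\<^esub> \<otimes>\<^bsub>L\<^esub> \<one>\<^bsub>L\<^esub>) = h \<one>\<^bsub>L\<^esub> \<otimes>\<^bsub>M\<^esub> h \<one>\<^bsub>L\<^esub>" "h \<one>\<^bsub>L\<^esub> \<in> carrier M"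
    using assms(3) L.one_closed by (auto simp: hom_def)
  then show ?thesis by (simp add: L.l_one L.one_closed M.square)
qed

lemma free_hom_eq_eval:
  assumes M: "steiner_loop M" and h: "h \<in> hom (free_steiner_loop X) M"
    and t: "t \<in> terms X"
  shows "h (steiner_cong X `` {t}) = eval_term M (\<lambda>x. h (free_gen X x)) t"
  using t
proof induction
  case (Prod s t)
  have "steiner_cong X `` {s} \<in> carrier (free_steiner_loop X)"
    "steiner_cong X `` {t} \<in> carrier (free_steiner_loop X)"
    using Prod by (auto simp: free_carrier_iff)
  with h have "h (steiner_cong X `` {s} \<otimes>\<^bsub>free_steiner_loop X\<^esub> steiner_cong X `` {t})
      = h (steiner_cong X `` {s}) \<otimes>\<^bsub>M\<^esub> h (steiner_cong X `` {t})"
    by (auto simp: hom_def)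
  then show ?case using Prod by (simp add: free_mult)
qed (use hom_one[OF steiner_loop_free M h] in \<open>auto simp: free_gen_def free_one\<close>)

lemma free_hom_eqI:
  assumes "steiner_loop M"
    and "h \<in> hom (free_steiner_loop X) M" "h' \<in> hom (free_steiner_loop X) M"
    and "\<And>x. x \<in> X \<Longrightarrow> h (free_gen X x) = h' (free_gen X x)"
    and "A \<in> carrier (free_steiner_loop X)"
  shows "h A = h' A"
proof -
  obtain t where t: "t \<in> terms X" "A = steiner_cong X `` {t}"
    using assms(5) by (auto simp: free_carrier_iff)
  have "eval_term M (\<lambda>x. h (free_gen X x)) t = eval_term M (\<lambda>x. h' (free_gen X x)) t"
    using t(1) by induction (auto simp: assms(4))
  with t show ?thesis
    by (simp add: free_hom_eq_eval[OF assms(1) assms(2)] free_hom_eq_eval[OF assms(1) assms(3)])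
qed

theorem free_universal:
  assumes M: "steiner_loop M" and f: "f \<in> X \<rightarrow> carrier M"
  shows "\<exists>!h. h \<in> hom (free_steiner_loop X) M \<inter> extensional (carrier (free_steiner_loop X))
    \<and> (\<forall>x\<in>X. h (free_gen X x) = f x)"
proof (rule ex_ex1I)
  define h where "h = restrict (\<lambda>A. eval_term M f (SOME t. t \<in> A)) (carrier (free_steiner_loop X))"
  have h: "h (steiner_cong X `` {t}) = eval_term M f t" if t: "t \<in> terms X" for t
  proof -
    have "t \<in> steiner_cong X `` {t}" using steiner_cong.refl[OF t] by simp
    then have "(SOME s. s \<in> steiner_cong X `` {t}) \<in> steiner_cong X `` {t}"
      by (rule someI)
    then have "(t, SOME s. s \<in> steiner_cong X `` {t}) \<in> steiner_cong X"
      by (simp only: Image_singleton_iff)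
    then have "eval_term M f t = eval_term M f (SOME s. s \<in> steiner_cong X `` {t})"
      by (rule eval_term_cong[OF M f])
    moreover have "steiner_cong X `` {t} \<in> carrier (free_steiner_loop X)"
      using t by (auto simp: free_carrier_iff)
    ultimately show ?thesis by (simp only: h_def restrict_apply')
  qed
  have "h \<in> hom (free_steiner_loop X) M"
    unfolding hom_def
  proof (intro CollectI conjI ballI Pi_I)
    fix A B assume "A \<in> carrier (free_steiner_loop X)" "B \<in> carrier (free_steiner_loop X)"
    then obtain s t where st: "s \<in> terms X" "t \<in> terms X"
      "A = steiner_cong X `` {s}" "B = steiner_cong X `` {t}"
      by (auto simp: free_carrier_iff)
    show "h (A \<otimes>\<^bsub>free_steiner_loop X\<^esub> B) = h A \<otimes>\<^bsub>M\<^esub> h B"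
      using st by (simp add: free_mult h terms.Prod)
  next
    fix A assume "A \<in> carrier (free_steiner_loop X)"
    then obtain s where "s \<in> terms X" "A = steiner_cong X `` {s}"
      by (auto simp: free_carrier_iff)
    then show "h A \<in> carrier M" by (simp add: h eval_term_closed[OF M f])
  qed
  moreover have "h \<in> extensional (carrier (free_steiner_loop X))" by (simp add: h_def)
  moreover have "\<forall>x\<in>X. h (free_gen X x) = f x" by (simp add: free_gen_def h terms.Var)
  ultimately show "\<exists>h. h \<in> hom (free_steiner_loop X) M \<inter> extensional (carrier (free_steiner_loop X))
    \<and> (\<forall>x\<in>X. h (free_gen X x) = f x)" by (intro exI[of _ h]) simp
next
  fix h h'
  assume h: "h \<in> hom (free_steiner_loop X) M \<inter> extensional (carrier (free_steiner_loop X))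
      \<and> (\<forall>x\<in>X. h (free_gen X x) = f x)"
    and h': "h' \<in> hom (free_steiner_loop X) M \<inter> extensional (carrier (free_steiner_loop X))
      \<and> (\<forall>x\<in>X. h' (free_gen X x) = f x)"
  show "h = h'"
  proof (rule extensionalityI)
    show "h \<in> extensional (carrier (free_steiner_loop X))" using h by simp
    show "h' \<in> extensional (carrier (free_steiner_loop X))" using h' by simp
    fix A assume "A \<in> carrier (free_steiner_loop X)"
    show "h A = h' A"
      by (rule free_hom_eqI[OF M, of h X h']) (use h h' \<open>A \<in> _\<close> in simp_all)
  qed
qed

lemma inj_on_free_gen: "inj_on (free_gen X) X"
proof (rule inj_onI)
  fix x y assume xy: "x \<in> X" "y \<in> X" "free_gen X x = free_gen X y"
  define M :: "bool monoid" where "M = \<lparr>carrier = UNIV, mult = (\<noteq>), one = False\<rparr>"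
  have M: "steiner_loop M" by (rule steiner_loopI) (auto simp: M_def)
  have "(\<lambda>z. z = x) \<in> X \<rightarrow> carrier M" by (auto simp: M_def)
  from free_universal[OF M this]
  obtain h where h: "\<And>z. z \<in> X \<Longrightarrow> h (free_gen X z) \<longleftrightarrow> z = x" by blast
  show "x = y" using h[OF xy(1)] h[OF xy(2)] xy(3) by metis
qed

section \<open>Tame automorphisms\<close>

definition elementary_aut ::
    "'a set \<Rightarrow> 'a \<Rightarrow> 'a loop_term set \<Rightarrow> 'a loop_term set \<Rightarrow> 'a loop_term set"
  where "elementary_aut X x v = (THE \<phi>.
    \<phi> \<in> auto (free_steiner_loop X)
    \<and> \<phi> (free_gen X x) = free_gen X x \<otimes>\<^bsub>free_steiner_loop X\<^esub> v
    \<and> (\<forall>y\<in>X - {x}. \<phi> (free_gen X y) = free_gen X y))"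

definition elementary_auts :: "'a set \<Rightarrow> ('a loop_term set \<Rightarrow> 'a loop_term set) set"
  where "elementary_auts X = {elementary_aut X x v | x v.
    x \<in> X \<and> v \<in> subloop_generated (free_steiner_loop X) (free_gen X ` (X - {x}))}"

definition tame_auts :: "'a set \<Rightarrow> ('a loop_term set \<Rightarrow> 'a loop_term set) set"
  where "tame_auts X = generate (AutoGroup (free_steiner_loop X)) (elementary_auts X)"

text \<open>The description in \<^const>\<open>elementary_aut\<close> is always met by exactly one map.\<close>

lemma subloop_generated_subset:
  assumes "steiner_loop L" "A \<subseteq> carrier L"
  shows "subloop_generated L A \<subseteq> carrier L"
proof -
  interpret steiner_loop L by fact
  have "loop (L\<lparr>carrier := carrier L\<rparr>)" by (simp add: loop_axioms)
  with assms(2) show ?thesis by (auto simp: subloop_generated_def subloop_def)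
qed

lemma hom_fixes_subloop_generated:
  assumes L: "steiner_loop L" and A: "A \<subseteq> carrier L" and h: "h \<in> hom L L"
    and fix_A: "\<And>a. a \<in> A \<Longrightarrow> h a = a" and v: "v \<in> subloop_generated L A"
  shows "h v = v"
proof -
  interpret steiner_loop L by fact
  define E where "E = {a \<in> carrier L. h a = a}"
  have "steiner_loop (L\<lparr>carrier := E\<rparr>)"
    by (rule steiner_loopI)
      (use h hom_one[OF L L h] in
        \<open>simp_all add: E_def hom_def m_closed one_closed l_one r_one square cancel comm\<close>)
  then have "subloop E L"
    by (auto simp: subloop_def E_def steiner_loop_def)
  moreover have "A \<subseteq> E" using A fix_A by (auto simp: E_def)
  ultimately have "v \<in> E" using v by (auto simp: subloop_generated_def)
  then show ?thesis by (simp add: E_def)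
qed

theorem elementary_aut_unique_existence:
  assumes x: "x \<in> X"
    and v: "v \<in> subloop_generated (free_steiner_loop X) (free_gen X ` (X - {x}))"
  shows "\<exists>!\<phi>. \<phi> \<in> auto (free_steiner_loop X)
    \<and> \<phi> (free_gen X x) = free_gen X x \<otimes>\<^bsub>free_steiner_loop X\<^esub> v
    \<and> (\<forall>y\<in>X - {x}. \<phi> (free_gen X y) = free_gen X y)"
proof (rule ex_ex1I)
  let ?S = "free_steiner_loop X"
  interpret S: steiner_loop ?S by (rule steiner_loop_free)
  have gens: "free_gen X ` (X - {x}) \<subseteq> carrier ?S" by (auto intro: free_gen_closed)
  have vS: "v \<in> carrier ?S"
    using subloop_generated_subset[OF steiner_loop_free gens] v by blast
  define f where "f y = (if y = x then free_gen X x \<otimes>\<^bsub>?S\<^esub> v else free_gen X y)" for y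
  have "f \<in> X \<rightarrow> carrier ?S"
    using vS by (simp add: f_def S.m_closed free_gen_closed)
  from free_universal[OF steiner_loop_free this]
  obtain \<phi> where \<phi>: "\<phi> \<in> hom ?S ?S" "\<phi> \<in> extensional (carrier ?S)"
    and \<phi>f: "\<And>y. y \<in> X \<Longrightarrow> \<phi> (free_gen X y) = f y" by blast
  have fixv: "\<phi> v = v"
    by (rule hom_fixes_subloop_generated[OF steiner_loop_free gens \<phi>(1) _ v])
      (auto simp: \<phi>f f_def)
  have closed: "\<phi> A \<in> carrier ?S" if "A \<in> carrier ?S" for A
    using \<phi>(1) that by (auto simp: hom_def)
  have \<phi>x: "\<phi> (\<phi> (free_gen X x)) = free_gen X x"
  proof -
    have "\<phi> (\<phi> (free_gen X x)) = \<phi> (free_gen X x) \<otimes>\<^bsub>?S\<^esub> \<phi> v"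
      using \<phi>(1) x vS free_gen_closed[OF x] by (simp add: \<phi>f[OF x] f_def hom_def)
    also have "\<dots> = v \<otimes>\<^bsub>?S\<^esub> (v \<otimes>\<^bsub>?S\<^esub> free_gen X x)"
      using vS free_gen_closed[OF x] by (simp add: \<phi>f[OF x] f_def fixv S.comm S.m_closed)
    finally show ?thesis using vS free_gen_closed[OF x] by (simp add: S.cancel)
  qed
  have inv: "\<phi> (\<phi> A) = A" if "A \<in> carrier ?S" for A
  proof -
    have "(\<lambda>A. \<phi> (\<phi> A)) \<in> hom ?S ?S" using \<phi>(1) by (auto simp: hom_def Pi_iff)
    moreover have "(\<lambda>A. A) \<in> hom ?S ?S" by (auto simp: hom_def)
    moreover have "\<phi> (\<phi> (free_gen X y)) = free_gen X y" if "y \<in> X" for y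
      using that \<phi>x by (cases "y = x") (auto simp: \<phi>f f_def)
    ultimately show ?thesis
      using free_hom_eqI[OF steiner_loop_free, of "\<lambda>A. \<phi> (\<phi> A)" X X "\<lambda>A. A"] that by blast
  qed
  have "bij_betw \<phi> (carrier ?S) (carrier ?S)"
    by (rule bij_betw_byWitness[where f' = \<phi>]) (auto simp: inv closed)
  then have "\<phi> \<in> auto ?S" using \<phi> by (auto simp: auto_def Bij_def)
  moreover have "\<phi> (free_gen X x) = free_gen X x \<otimes>\<^bsub>?S\<^esub> v" by (simp add: \<phi>f[OF x] f_def)
  moreover have "\<forall>y\<in>X - {x}. \<phi> (free_gen X y) = free_gen X y" by (auto simp: \<phi>f f_def)
  ultimately show "\<exists>\<phi>. \<phi> \<in> auto ?S \<and> \<phi> (free_gen X x) = free_gen X x \<otimes>\<^bsub>?S\<^esub> v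
    \<and> (\<forall>y\<in>X - {x}. \<phi> (free_gen X y) = free_gen X y)" by blast
next
  let ?S = "free_steiner_loop X"
  fix \<phi> \<psi>
  assume \<phi>: "\<phi> \<in> auto ?S \<and> \<phi> (free_gen X x) = free_gen X x \<otimes>\<^bsub>?S\<^esub> v
    \<and> (\<forall>y\<in>X - {x}. \<phi> (free_gen X y) = free_gen X y)"
    and \<psi>: "\<psi> \<in> auto ?S \<and> \<psi> (free_gen X x) = free_gen X x \<otimes>\<^bsub>?S\<^esub> v
    \<and> (\<forall>y\<in>X - {x}. \<psi> (free_gen X y) = free_gen X y)"
  have "\<phi> (free_gen X y) = \<psi> (free_gen X y)" if "y \<in> X" for y
    using \<phi> \<psi> that by (cases "y = x") auto
  then show "\<phi> = \<psi>"
    using \<phi> \<psi> free_hom_eqI[OF steiner_loop_free, of \<phi> X X \<psi>]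
    by (intro extensionalityI[of \<phi> "carrier ?S" \<psi>]) (simp_all add: auto_def Bij_def)
qed

end

theory Submission
  imports Defs "HOL-Library.FSet"
begin

text \<open>
  Elements of the free Steiner loop have normal forms: reduced words, built from generators by
  unordered pairs \<open>{u, v}\<close> with \<open>u \<noteq> v\<close> and neither word an immediate factor of the other. Among
  the automorphisms \<open>\<phi> \<circ> e\<^sub>1 \<circ> \<dots> \<circ> e\<^sub>k\<close> with \<open>e\<^sub>i\<close> elementary, take one for which the total
  size of the words \<open>\<phi> x\<close>, \<open>x \<in> X\<close>, cannot be decreased by a further elementary step. Such a
  \<open>\<phi>\<close> maps every reduced pair \<open>{s, r}\<close> to the reduced pair \<open>{\<phi> s, \<phi> r}\<close>: if \<open>\<phi> s = {\<phi> r, w}\<close>,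
  then, by induction and injectivity, \<open>s\<close> is a generator. If \<open>r\<close> avoids \<open>s\<close>, replacing \<open>s\<close> by
  \<open>s \<cdot> r\<close> shortens \<open>\<phi> s\<close> to \<open>w\<close>; if \<open>r\<close> involves \<open>s\<close>, then \<open>\<phi> r\<close> is at least as long as \<open>\<phi> s\<close>.
  Both are impossible. Hence only generators are mapped to generators, and by finiteness \<open>\<phi>\<close>
  permutes them.
\<close>

section \<open>Reduced words\<close>

text \<open>Finite sets encode unordered pairs, so commutativity is built into the words; only nodes
  made by \<open>pr\<close> occur in \<open>red\<close>.\<close>

datatype 'a word = One | Gen 'a | Node "'a word fset"

lemma fdoubleton_eq_iff: "{|a, b|} = {|c, d|} \<longleftrightarrow> a = c \<and> b = d \<or> a = d \<and> b = c"
proof -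
  have "{|a, b|} = {|c, d|} \<longleftrightarrow> fset {|a, b|} = fset {|c, d|}" by (simp only: fset_inject)
  then show ?thesis by (simp add: doubleton_eq_iff)
qed

definition pr :: "'a word \<Rightarrow> 'a word \<Rightarrow> 'a word"
  where "pr u v = Node {|u, v|}"

lemma pr_eq_iff: "pr a b = pr c d \<longleftrightarrow> a = c \<and> b = d \<or> a = d \<and> b = c"
  by (simp add: pr_def fdoubleton_eq_iff)

lemma pr_cancel [simp]: "pr a b = pr a d \<longleftrightarrow> b = d" "pr a b = pr c a \<longleftrightarrow> b = c"
  by (auto simp: pr_eq_iff)

lemma pr_comm: "pr u v = pr v u"
  by (auto simp: pr_eq_iff)

lemma pr_neq [simp]: "pr u v \<noteq> One" "pr u v \<noteq> Gen x" "One \<noteq> pr u v" "Gen x \<noteq> pr u v"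
  by (simp_all add: pr_def)

text \<open>The case \<open>u = v\<close> is separate because the set then collapses to a
  singleton.\<close>

lemma size_pr [simp]: "size u < size (pr u v)" "size v < size (pr u v)"
  by (simp_all add: pr_def) (cases "u = v"; simp)+

definition factor :: "'a word \<Rightarrow> 'a word \<Rightarrow> bool"
  where "factor u v \<longleftrightarrow> (\<exists>w. v = pr u w)"

lemma factor_pr [simp]: "factor u (pr a b) \<longleftrightarrow> u = a \<or> u = b"
  by (auto simp: factor_def pr_eq_iff)

lemma factor_size: "factor u v \<Longrightarrow> size u < size v"
  by (auto simp: factor_def)

text \<open>The side conditions exclude the pairs that a Steiner identity rewrites: equal words
  (square) and a word with its own immediate factor (cancellation). \<open>One\<close> stays
  outside, so no pair multiplies by it.\<close>

inductive_set red :: "'a set \<Rightarrow> 'a word set" for X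
  where
    Gen: "x \<in> X \<Longrightarrow> Gen x \<in> red X"
  | pr: "\<lbrakk>u \<in> red X; v \<in> red X; u \<noteq> v; \<not> factor u v; \<not> factor v u\<rbrakk> \<Longrightarrow> pr u v \<in> red X"

lemma One_not_red [simp]: "One \<notin> red X"
  by (rule notI, erule red.cases) simp_all

lemma red_prD:
  assumes "pr u v \<in> red X"
  shows "u \<in> red X" "v \<in> red X" "u \<noteq> v" "\<not> factor u v" "\<not> factor v u"
  using assms by (cases "pr u v" rule: red.cases; auto simp: pr_eq_iff)+

section \<open>Multiplication of reduced words\<close>

definition mul :: "'a word \<Rightarrow> 'a word \<Rightarrow> 'a word"
  where "mul u v =
    (if u = One then v else if v = One then u else if u = v then One
     else if factor u v then (THE w. v = pr u w)
     else if factor v u then (THE w. u = pr v w) else pr u v)"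

definition words :: "'a set \<Rightarrow> 'a word monoid"
  where "words X = \<lparr>carrier = insert One (red X), mult = mul, one = One\<rparr>"

lemma words_simps [simp]:
  "carrier (words X) = insert One (red X)" "mult (words X) = mul" "one (words X) = One"
  by (simp_all add: words_def)

lemma mul_One [simp]: "mul One v = v" "mul v One = v" "mul v v = One"
  by (auto simp: mul_def)

text \<open>The order of the tests in \<open>mul\<close> is harmless: by size, two words cannot be
  immediate factors of each other.\<close>

lemma mul_comm: "mul u v = mul v u"
proof -
  have "\<not> (factor u v \<and> factor v u)" by (auto dest!: factor_size)
  then show ?thesis by (auto simp: mul_def pr_comm)
qed

lemma mul_pr1:
  assumes "u \<noteq> One"
  shows "mul u (pr u w) = w"
proof -
  have "u \<noteq> pr u w" by (metis size_pr(1) less_irrefl)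
  then show ?thesis using assms by (simp add: mul_def)
qed

lemma mul_pr: "pr u v \<in> red X \<Longrightarrow> mul u v = pr u v"
  by (frule red_prD(3), frule red_prD(4), frule red_prD(5), frule red_prD(1), frule red_prD(2))
    (auto simp: mul_def)

text \<open>One reduction finishes any product, since the cofactor \<open>w\<close> in a reduced
  pair is itself reduced.\<close>

lemma mul_cases [consumes 2, case_names One1 One2 eq factor1 factor2 pr]:
  assumes "u \<in> insert One (red X)" "v \<in> insert One (red X)"
  obtains "u = One" | "v = One" | "u = v"
  | w where "v = pr u w" "v \<in> red X" "u \<noteq> One"
  | w where "u = pr v w" "u \<in> red X" "v \<noteq> One"
  | "pr u v \<in> red X" "u \<in> red X" "v \<in> red X"
proof -
  consider "u = One" | "v = One" | "u = v" | "factor u v" "u \<in> red X" "v \<in> red X"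
    | "factor v u" "u \<in> red X" "v \<in> red X"
    | "\<not> factor v u" "\<not> factor u v" "u \<noteq> v" "u \<in> red X" "v \<in> red X" using assms by auto
  then show ?thesis
  proof cases
    case 6
    then show ?thesis using that(6) red.pr by blast
  qed (use that in \<open>auto simp: factor_def\<close>)
qed

lemma steiner_loop_words: "steiner_loop (words X)"
proof (rule steiner_loopI)
  fix u v :: "'a word"
  assume uv: "u \<in> carrier (words X)" "v \<in> carrier (words X)"
  then have uv': "u \<in> insert One (red X)" "v \<in> insert One (red X)" by simp_all
  show "u \<otimes>\<^bsub>words X\<^esub> v \<in> carrier (words X)"
    using uv'
    by (cases rule: mul_cases)
      (use uv' in \<open>auto simp: mul_pr1 mul_pr mul_comm[of "pr _ _"] dest: red_prD\<close>)
  show "u \<otimes>\<^bsub>words X\<^esub> (u \<otimes>\<^bsub>words X\<^esub> v) = v"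
    using uv'
  proof (cases rule: mul_cases)
    case (factor1 w)
    then show ?thesis by (simp add: mul_pr1 mul_pr)
  next
    case (factor2 w)
    \<comment> \<open>Here \<open>u = pr v w\<close> and \<open>u v = w\<close>, so the claim is
      \<open>u w = v\<close>; cancelling \<open>w\<close> from \<open>pr w v\<close> requires
      \<open>w\<close> to differ from \<open>One\<close>.\<close>
    then have "w \<noteq> One" using red_prD(2) by fastforce
    with factor2 show ?thesis
      by (simp add: mul_comm[of "pr _ _"] mul_pr1) (simp add: mul_pr1 pr_comm[of v w])
  next
    case pr
    then show ?thesis using mul_pr1 One_not_red by (metis mul_pr words_simps(2))
  qed auto
qed (auto simp: mul_comm)

section \<open>Normal forms in the free Steiner loop\<close>

text \<open>Well defined on doubletons only because the loop is commutative.\<close>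

definition fold_pair :: "('b, 'c) monoid_scheme \<Rightarrow> 'b fset \<Rightarrow> 'b"
  where "fold_pair L B = (THE c. \<exists>a\<in>carrier L. \<exists>b\<in>carrier L. B = {|a, b|} \<and> c = a \<otimes>\<^bsub>L\<^esub> b)"

primrec eval_word :: "('b, 'c) monoid_scheme \<Rightarrow> ('a \<Rightarrow> 'b) \<Rightarrow> 'a word \<Rightarrow> 'b"
  where
    "eval_word L f One = \<one>\<^bsub>L\<^esub>"
  | "eval_word L f (Gen x) = f x"
  | "eval_word L f (Node B) = fold_pair L (eval_word L f |`| B)"

text \<open>The case \<open>a = b\<close> matters: distinct words may have equal values, and the
  resulting singleton must still yield the square.\<close>

lemma fold_pair_doubleton:
  assumes "steiner_loop L" "a \<in> carrier L" "b \<in> carrier L"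
  shows "fold_pair L {|a, b|} = a \<otimes>\<^bsub>L\<^esub> b"
proof -
  interpret steiner_loop L by fact
  have "c = a \<otimes>\<^bsub>L\<^esub> b"
    if "{|a, b|} = {|a', b'|}" "c = a' \<otimes>\<^bsub>L\<^esub> b'" for c a' b'
  proof -
    have "a = a' \<and> b = b' \<or> a = b' \<and> b = a'"
      using that(1) by (simp only: fdoubleton_eq_iff)
    then show ?thesis using that(2) assms comm by auto
  qed
  then show ?thesis unfolding fold_pair_def using assms by (intro the_equality) blast+
qed

lemma eval_word_closed:
  assumes "steiner_loop L" "f \<in> X \<rightarrow> carrier L" "w \<in> red X"
  shows "eval_word L f w \<in> carrier L"
proof -
  interpret steiner_loop L by fact
  show ?thesis using assms(3)
    by induction (use assms(1,2) m_closed in \<open>auto simp: pr_def fold_pair_doubleton\<close>)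
qed

lemma eval_word_pr:
  assumes "steiner_loop L" "f \<in> X \<rightarrow> carrier L" "pr u v \<in> red X"
  shows "eval_word L f (pr u v) = eval_word L f u \<otimes>\<^bsub>L\<^esub> eval_word L f v"
  using assms(1) eval_word_closed[OF assms(1,2)] red_prD(1,2)[OF assms(3)]
  by (simp add: pr_def fold_pair_doubleton)

text \<open>Each reduction made by \<open>mul\<close> is an instance of a Steiner identity, which
  holds in \<open>L\<close> as well.\<close>

lemma eval_word_hom:
  assumes "steiner_loop L" "f \<in> X \<rightarrow> carrier L"
  shows "eval_word L f \<in> hom (words X) L"
proof -
  interpret steiner_loop L by fact
  let ?k = "eval_word L f"
  note e = eval_word_pr[OF assms] and cl = eval_word_closed[OF assms]
  have cl': "?k u \<in> carrier L" if "u \<in> insert One (red X)" for u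
    using that cl one_closed by auto
  have "?k (mul u v) = ?k u \<otimes>\<^bsub>L\<^esub> ?k v"
    if uv: "u \<in> insert One (red X)" "v \<in> insert One (red X)" for u v
    using that
  proof (cases rule: mul_cases)
    case (factor1 w)
    then show ?thesis using e[of u w] red_prD[of u w X] by (simp add: mul_pr1 cancel cl)
  next
    case (factor2 w)
    then show ?thesis using e[of v w] red_prD[of v w X]
      by (simp add: mul_comm[of "pr _ _"] mul_pr1 cancel cl comm[of "_ \<otimes>\<^bsub>L\<^esub> _"] m_closed)
  qed (use uv cl' in \<open>auto simp: l_one r_one square mul_pr e\<close>)
  then show ?thesis using cl by (auto simp: hom_def one_closed l_one r_one)
qed

text \<open>The letters generate: by \<open>mul_pr\<close> a reduced pair is the product of its two
  parts.\<close>

lemma words_hom_eqI: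
  assumes "steiner_loop M" "h \<in> hom (words X) M" "h' \<in> hom (words X) M"
    and "\<And>x. x \<in> X \<Longrightarrow> h (Gen x) = h' (Gen x)" and "w \<in> insert One (red X)"
  shows "h w = h' w"
proof (cases "w = One")
  case True
  then show ?thesis
    using hom_one[OF steiner_loop_words assms(1,2)] hom_one[OF steiner_loop_words assms(1,3)] by simp
next
  case False
  then have "w \<in> red X" using assms(5) by simp
  then show ?thesis
  proof induction
    case (pr u v)
    then have "mul u v = pr u v" using red.pr mul_pr by metis
    with pr show ?case using assms(2,3) unfolding hom_def by fastforce
  qed (rule assms(4))
qed

text \<open>The universal property gives \<open>h\<close>, evaluation of words gives
  \<open>k\<close>; both composites fix the generators, hence are identities. Reduced words are thus
  normal forms.\<close>

lemma free_iso_words: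
  obtains h k where "h \<in> hom (free_steiner_loop X) (words X)" "k \<in> hom (words X) (free_steiner_loop X)"
    "\<And>x. x \<in> X \<Longrightarrow> h (free_gen X x) = Gen x" "\<And>x. x \<in> X \<Longrightarrow> k (Gen x) = free_gen X x"
    "\<And>A. A \<in> carrier (free_steiner_loop X) \<Longrightarrow> k (h A) = A"
    "\<And>w. w \<in> insert One (red X) \<Longrightarrow> h (k w) = w"
proof -
  let ?S = "free_steiner_loop X"
  have "Gen \<in> X \<rightarrow> carrier (words X)" by (auto intro: red.Gen)
  from free_universal[OF steiner_loop_words this]
  obtain h where h: "h \<in> hom ?S (words X)" "\<And>x. x \<in> X \<Longrightarrow> h (free_gen X x) = Gen x" by blast
  let ?k = "eval_word ?S (free_gen X)"
  have k: "?k \<in> hom (words X) ?S"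
    by (rule eval_word_hom[OF steiner_loop_free]) (auto intro: free_gen_closed)
  have "?k (h A) = A" if "A \<in> carrier ?S" for A
  proof -
    have "(\<lambda>A. ?k (h A)) \<in> hom ?S ?S" using Group.hom_compose[OF h(1) k] by (simp add: comp_def)
    moreover have "(\<lambda>A. A) \<in> hom ?S ?S" by (auto simp: hom_def)
    ultimately show ?thesis
      by (rule free_hom_eqI[OF steiner_loop_free, of "\<lambda>A. ?k (h A)" X X "\<lambda>A. A"])
        (simp_all add: h(2) that)
  qed
  moreover have "h (?k w) = w" if "w \<in> insert One (red X)" for w
  proof -
    have "(\<lambda>A. h (?k A)) \<in> hom (words X) (words X)"
      using Group.hom_compose[OF k h(1)] by (simp add: comp_def)
    moreover have "(\<lambda>A. A) \<in> hom (words X) (words X)" by (auto simp: hom_def)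
    ultimately show ?thesis
      by (rule words_hom_eqI[OF steiner_loop_words, of "\<lambda>A. h (?k A)" X X "\<lambda>A. A"])
        (use h(2) that in simp_all)
  qed
  ultimately show ?thesis using h k that[of h ?k] by simp
qed

section \<open>Automorphisms without length-reducing elementary transformations\<close>

text \<open>\<open>irr\<close> says that no step \<open>x -> x r\<close> with \<open>r\<close> free
  of \<open>x\<close> shortens the image of \<open>x\<close>. Strong induction on size allows the
  images of all smaller pairs to be split into parts.\<close>

lemma irreducible_pr:
  fixes \<psi> :: "'a word \<Rightarrow> 'a word"
  assumes hom: "\<psi> \<in> hom (words X) (words X)" and inj: "inj_on \<psi> (insert One (red X))"
    and irr: "\<And>x r. \<lbrakk>x \<in> X; r \<in> red (X - {x})\<rbrakk>
      \<Longrightarrow> size (\<psi> (Gen x)) \<le> size (mul (\<psi> (Gen x)) (\<psi> r))"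
  shows "pr s r \<in> red X \<Longrightarrow> \<psi> (pr s r) = pr (\<psi> s) (\<psi> r)"
proof (induction "size (pr s r)" arbitrary: s r rule: less_induct)
  case less
  have One: "\<psi> One = One" using hom_one[OF steiner_loop_words steiner_loop_words hom] by simp
  have closed: "\<psi> u \<in> red X" if "u \<in> red X" for u
  proof -
    have "\<psi> u \<in> insert One (red X)" using hom that by (auto simp: hom_def)
    moreover have "\<psi> u \<noteq> One" using inj_onD[OF inj, of u One] One that by auto
    ultimately show ?thesis by simp
  qed
  have inj': "\<psi> u = \<psi> v \<longleftrightarrow> u = v" if "u \<in> red X" "v \<in> red X" for u v
    using inj that by (auto dest: inj_onD)
  have mult: "\<psi> (mul u v) = mul (\<psi> u) (\<psi> v)" if "u \<in> red X" "v \<in> red X" for u v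
    using hom that by (auto simp: hom_def)
  \<comment> \<open>Smaller pairs go to pairs, so an image is longer than the images of its parts;
    once \<open>Gen x\<close> occurs in \<open>u\<close>, the image of \<open>u\<close> is at least
    as long as that of \<open>Gen x\<close>.\<close>
  have avoids: "u \<in> red (X - {x}) \<or> size (\<psi> (Gen x)) \<le> size (\<psi> u)"
    if "u \<in> red X" "size u < size (pr s r)" for x u
    using that
  proof induction
    case (Gen y)
    then show ?case by (cases "y = x") (auto intro: red.Gen)
  next
    case (pr u v)
    have uv: "size u < size (pr u v)" "size v < size (pr u v)" by simp_all
    have "pr u v \<in> red X" using pr.hyps by (rule red.pr)
    then have eq: "\<psi> (pr u v) = pr (\<psi> u) (\<psi> v)" using less(1) pr.prems by blast
    have "size (\<psi> u) < size (\<psi> (pr u v))" "size (\<psi> v) < size (\<psi> (pr u v))"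
      by (simp_all add: eq)
    moreover have "u \<in> red (X - {x}) \<or> size (\<psi> (Gen x)) \<le> size (\<psi> u)"
      "v \<in> red (X - {x}) \<or> size (\<psi> (Gen x)) \<le> size (\<psi> v)"
      using pr.IH pr.prems uv by linarith+
    moreover have "pr u v \<in> red (X - {x})" if "u \<in> red (X - {x})" "v \<in> red (X - {x})"
      using that pr.hyps by (intro red.pr)
    ultimately show ?case by linarith
  qed
  \<comment> \<open>Stated for \<open>a\<close> and \<open>b\<close> to cover both orders of the
    unordered pair.\<close>
  have no_factor: "\<not> factor (\<psi> b) (\<psi> a)" if ab: "pr a b = pr s r" for a b
  proof
    have red: "pr a b \<in> red X" using less(2) ab by simp
    note D = red_prD[OF red]
    have sz: "size a < size (pr s r)" "size b < size (pr s r)" by (metis ab size_pr(1)) (metis ab size_pr(2))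
    assume f: "factor (\<psi> b) (\<psi> a)"
    then obtain w where w: "\<psi> a = pr (\<psi> b) w" by (auto simp: factor_def)
    show False using D(1)
    proof cases
      case (Gen x)
      \<comment> \<open>Multiplying by \<open>\<psi> b\<close> strips \<open>\<psi> a\<close> down
        to \<open>w\<close>. If \<open>b\<close> avoids \<open>x\<close>, \<open>irr\<close> forbids
        this; otherwise \<open>avoids\<close> makes the factor \<open>\<psi> b\<close> at least as
        long as \<open>\<psi> a\<close>.\<close>
      have "mul (\<psi> a) (\<psi> b) = w"
        using w mul_pr1[of "\<psi> b" w] closed[OF D(2)] One_not_red by (metis mul_comm)
      then have "size (mul (\<psi> a) (\<psi> b)) < size (\<psi> a)" using w by simp
      moreover have "size (\<psi> b) < size (\<psi> a)" using f by (rule factor_size)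
      ultimately show False
        using avoids[OF D(2) sz(2), of x] irr[of x b] Gen by auto
    next
      case (pr u v)
      \<comment> \<open>By the induction hypothesis and injectivity, \<open>b\<close> is an
        immediate factor of \<open>a\<close>, contrary to reducedness of
        \<open>pr a b\<close>.\<close>
      then have "\<psi> a = pr (\<psi> u) (\<psi> v)" using less(1)[of u v] sz(1) D(1) by simp
      then have "\<psi> b = \<psi> u \<or> \<psi> b = \<psi> v" using f by simp
      then have "b = u \<or> b = v" using inj' D(2) pr by blast
      then show False using D(5) pr by simp
    qed
  qed
  note D = red_prD[OF less(2)]
  have "pr (\<psi> s) (\<psi> r) \<in> red X"
    using no_factor[OF HOL.refl] no_factor[OF pr_comm] D inj' closed by (intro red.pr) auto
  then show ?case using mult[OF D(1,2)] mul_pr less(2) by metis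
qed

text \<open>Surjectivity gives a preimage of \<open>Gen x\<close>; pairs go to pairs and
  \<open>One\<close> to \<open>One\<close>, so it is a generator.\<close>

lemma irreducible_permutes_generators:
  fixes \<psi> :: "'a word \<Rightarrow> 'a word"
  assumes hom: "\<psi> \<in> hom (words X) (words X)"
    and bij: "bij_betw \<psi> (insert One (red X)) (insert One (red X))"
    and irr: "\<And>x r. \<lbrakk>x \<in> X; r \<in> red (X - {x})\<rbrakk>
      \<Longrightarrow> size (\<psi> (Gen x)) \<le> size (mul (\<psi> (Gen x)) (\<psi> r))"
    and x: "x \<in> X"
  shows "\<exists>y\<in>X. \<psi> (Gen y) = Gen x"
proof -
  have inj: "inj_on \<psi> (insert One (red X))" using bij by (simp add: bij_betw_def)
  have One: "\<psi> One = One" using hom_one[OF steiner_loop_words steiner_loop_words hom] by simp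
  have "Gen x \<in> \<psi> ` insert One (red X)" using bij x by (simp add: bij_betw_def red.Gen)
  then obtain t where t: "t \<in> insert One (red X)" "\<psi> t = Gen x" by (metis imageE)
  then have "t \<in> red X" using One by auto
  then show ?thesis
  proof cases
    case (pr u v)
    then have "\<psi> t = pr (\<psi> u) (\<psi> v)" using irreducible_pr[OF hom inj irr] \<open>t \<in> red X\<close> by blast
    then show ?thesis using t by simp
  qed (use t in auto)
qed

section \<open>The automorphism group\<close>

text \<open>Composition is associative whatever the loop product, so it suffices to find a subgroup
  of the bijections.\<close>

lemma group_AutoGroup:
  assumes "steiner_loop L"
  shows "group (AutoGroup L)"
proof -
  interpret L: steiner_loop L by fact
  interpret B: group "BijGroup (carrier L)" by (rule group_BijGroup)
  have id: "(\<lambda>x\<in>carrier L. x) \<in> auto L"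
    by (auto simp: auto_def hom_def id_Bij L.m_closed)
  have "subgroup (auto L) (BijGroup (carrier L))"
  proof (rule B.subgroupI)
    show "auto L \<subseteq> carrier (BijGroup (carrier L))" by (auto simp: auto_def BijGroup_def)
    show "auto L \<noteq> {}" using id by auto
  next
    fix f assume f: "f \<in> auto L"
    then have "inv\<^bsub>BijGroup (carrier L)\<^esub> f = restrict (inv_into (carrier L) f) (carrier L)"
      by (simp add: auto_def inv_BijGroup restrict_def)
    moreover have "restrict (inv_into (carrier L) f) (carrier L) \<in> hom L L"
    proof (rule homI)
      fix x y assume xy: "x \<in> carrier L" "y \<in> carrier L"
      have "inv_into (carrier L) f (x \<otimes>\<^bsub>L\<^esub> y)
          = inv_into (carrier L) f x \<otimes>\<^bsub>L\<^esub> inv_into (carrier L) f y"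
        by (rule Bij_inv_into_lemma) (use f xy L.m_closed in \<open>auto simp: auto_def hom_def\<close>)
      then show "restrict (inv_into (carrier L) f) (carrier L) (x \<otimes>\<^bsub>L\<^esub> y)
          = restrict (inv_into (carrier L) f) (carrier L) x
            \<otimes>\<^bsub>L\<^esub> restrict (inv_into (carrier L) f) (carrier L) y"
        using xy by (simp add: L.m_closed)
    qed (use f in \<open>auto simp: auto_def Bij_inv_into_mem\<close>)
    ultimately show "inv\<^bsub>BijGroup (carrier L)\<^esub> f \<in> auto L"
      using f restrict_inv_into_Bij by (auto simp: auto_def restrict_def)
  next
    fix f g assume fg: "f \<in> auto L" "g \<in> auto L"
    then have "compose (carrier L) f g \<in> hom L L"
      by (auto simp: auto_def hom_def compose_def L.m_closed Pi_iff)
    then show "f \<otimes>\<^bsub>BijGroup (carrier L)\<^esub> g \<in> auto L"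
      using fg by (auto simp: auto_def BijGroup_def compose_Bij)
  qed
  then show ?thesis
    unfolding AutoGroup_def by (rule subgroup.subgroup_is_group) (rule group_BijGroup)
qed

lemma carrier_AutoGroup [simp]: "carrier (AutoGroup L) = auto L"
  by (simp add: AutoGroup_def)

lemma AutoGroup_mult_apply:
  assumes "f \<in> auto L" "g \<in> auto L" "a \<in> carrier L"
  shows "(f \<otimes>\<^bsub>AutoGroup L\<^esub> g) a = f (g a)"
  using assms by (simp add: AutoGroup_def BijGroup_def auto_def compose_eq)

lemma AutoGroup_one: "\<one>\<^bsub>AutoGroup L\<^esub> = (\<lambda>a\<in>carrier L. a)"
  by (simp add: AutoGroup_def BijGroup_def)

section \<open>Tame automorphisms\<close>

lemma elementary_aut_props:
  assumes "x \<in> X" "v \<in> subloop_generated (free_steiner_loop X) (free_gen X ` (X - {x}))"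
  shows "elementary_aut X x v \<in> auto (free_steiner_loop X)"
    and "elementary_aut X x v (free_gen X x) = free_gen X x \<otimes>\<^bsub>free_steiner_loop X\<^esub> v"
    and "\<And>y. \<lbrakk>y \<in> X; y \<noteq> x\<rbrakk> \<Longrightarrow> elementary_aut X x v (free_gen X y) = free_gen X y"
    and "elementary_aut X x v \<in> elementary_auts X"
proof -
  show "elementary_aut X x v \<in> auto (free_steiner_loop X)"
    "elementary_aut X x v (free_gen X x) = free_gen X x \<otimes>\<^bsub>free_steiner_loop X\<^esub> v"
    "\<And>y. \<lbrakk>y \<in> X; y \<noteq> x\<rbrakk> \<Longrightarrow> elementary_aut X x v (free_gen X y) = free_gen X y"
    using theI'[OF elementary_aut_unique_existence[OF assms]]
    unfolding elementary_aut_def[symmetric] by auto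
  show "elementary_aut X x v \<in> elementary_auts X"
    using assms by (auto simp: elementary_auts_def)
qed

lemma elementary_auts_subset: "elementary_auts X \<subseteq> auto (free_steiner_loop X)"
  using elementary_aut_props(1) by (auto simp: elementary_auts_def)

text \<open>The step is undone by the inverse of \<open>e\<close>. The right factor acts first, so
  passing from \<open>\<phi>\<close> to its product with \<open>e\<close> changes the image of at
  most one generator.\<close>

lemma tame_cancel_elementary:
  assumes "\<phi> \<in> auto (free_steiner_loop X)" "e \<in> elementary_auts X"
    and "\<phi> \<otimes>\<^bsub>AutoGroup (free_steiner_loop X)\<^esub> e \<in> tame_auts X"
  shows "\<phi> \<in> tame_auts X"
proof -
  let ?A = "AutoGroup (free_steiner_loop X)"
  interpret A: group ?A by (rule group_AutoGroup[OF steiner_loop_free])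
  have e: "e \<in> carrier ?A" using assms(2) elementary_auts_subset by auto
  have "(\<phi> \<otimes>\<^bsub>?A\<^esub> e) \<otimes>\<^bsub>?A\<^esub> inv\<^bsub>?A\<^esub> e = \<phi>"
    using assms(1) e A.m_assoc A.r_inv A.r_one A.inv_closed carrier_AutoGroup by metis
  moreover have "(\<phi> \<otimes>\<^bsub>?A\<^esub> e) \<otimes>\<^bsub>?A\<^esub> inv\<^bsub>?A\<^esub> e \<in> tame_auts X"
    unfolding tame_auts_def
    by (rule generate.eng[OF assms(3)[unfolded tame_auts_def] generate.inv[OF assms(2)]])
  ultimately show ?thesis by simp
qed

lemma subloop_generated_incl: "A \<subseteq> subloop_generated L A"
  by (auto simp: subloop_generated_def)

text \<open>Turns the syntactic condition that a word avoids a generator into the subloop membership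
  demanded of elementary automorphisms.\<close>

lemma hom_word_mem_subloop_generated:
  assumes k: "k \<in> hom (words X) L" and Y: "Y \<subseteq> X" and w: "w \<in> red Y"
  shows "k w \<in> subloop_generated L (k ` Gen ` Y)"
  using w
proof induction
  case (Gen x)
  then show ?case using subloop_generated_incl by fast
next
  case (pr u v)
  have mono: "a \<in> red X" if "a \<in> red Y" for a
    using that by induction (use Y in \<open>auto intro: red.intros\<close>)
  have "pr u v \<in> red Y" using pr.hyps by (rule red.pr)
  then have "k (pr u v) = k u \<otimes>\<^bsub>L\<^esub> k v"
    using hom_mult[OF k, of u v] mono[OF pr.hyps(1)] mono[OF pr.hyps(2)] by (simp add: mul_pr)
  moreover have "k u \<otimes>\<^bsub>L\<^esub> k v \<in> H" if "subloop H L" "k ` Gen ` Y \<subseteq> H" for H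
  proof -
    have "loop (L\<lparr>carrier := H\<rparr>)" using that by (simp add: subloop_def)
    from loop.m_closed[OF this] show ?thesis
      using pr.IH that by (auto simp: subloop_generated_def)
  qed
  ultimately show ?case by (auto simp: subloop_generated_def)
qed

text \<open>A transposition of generators is a product of three elementary automorphisms
  \<open>x \<mapsto> xy\<close>, \<open>y \<mapsto> yx\<close>, \<open>x \<mapsto> xy\<close>.\<close>

lemma tame_cancel_transposition:
  assumes \<phi>: "\<phi> \<in> auto (free_steiner_loop X)" and xy: "x \<in> X" "y \<in> X" "x \<noteq> y"
    and tame: "\<And>\<phi>'. \<lbrakk>\<phi>' \<in> auto (free_steiner_loop X); \<phi>' (free_gen X x) = \<phi> (free_gen X y);
      \<phi>' (free_gen X y) = \<phi> (free_gen X x);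
      \<And>z. \<lbrakk>z \<in> X; z \<noteq> x; z \<noteq> y\<rbrakk> \<Longrightarrow> \<phi>' (free_gen X z) = \<phi> (free_gen X z)\<rbrakk> \<Longrightarrow> \<phi>' \<in> tame_auts X"
  shows "\<phi> \<in> tame_auts X"
proof -
  let ?S = "free_steiner_loop X" let ?A = "AutoGroup ?S" let ?g = "free_gen X"
  interpret S: steiner_loop ?S by (rule steiner_loop_free)
  interpret A: group ?A by (rule group_AutoGroup[OF steiner_loop_free])
  have "?g y \<in> subloop_generated ?S (?g ` (X - {x}))" "?g x \<in> subloop_generated ?S (?g ` (X - {y}))"
    using subloop_generated_incl xy by fast+
  note e1 = elementary_aut_props[OF xy(1) this(1)] and e2 = elementary_aut_props[OF xy(2) this(2)]
  let ?e1 = "elementary_aut X x (?g y)" let ?e2 = "elementary_aut X y (?g x)"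
  have g: "?g z \<in> carrier ?S" if "z \<in> X" for z using that by (rule free_gen_closed)
  have closed: "f \<otimes>\<^bsub>?A\<^esub> f' \<in> auto ?S" if "f \<in> auto ?S" "f' \<in> auto ?S" for f f'
    using A.m_closed that by simp
  note a1 = closed[OF \<phi> e1(1)]
  note a2 = closed[OF a1 e2(1)]
  note a3 = closed[OF a2 e1(1)]
  let ?\<phi>' = "((\<phi> \<otimes>\<^bsub>?A\<^esub> ?e1) \<otimes>\<^bsub>?A\<^esub> ?e2) \<otimes>\<^bsub>?A\<^esub> ?e1"
  have mult: "f (a \<otimes>\<^bsub>?S\<^esub> b) = f a \<otimes>\<^bsub>?S\<^esub> f b"
    if "f \<in> auto ?S" "a \<in> carrier ?S" "b \<in> carrier ?S" for f a b
    using that by (simp add: auto_def hom_def)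
  have app: "?\<phi>' a = \<phi> (?e1 (?e2 (?e1 a)))" if "a \<in> carrier ?S" for a
  proof -
    have "f a \<in> carrier ?S" if "f \<in> auto ?S" "a \<in> carrier ?S" for f a
      using that by (auto simp: auto_def hom_def)
    then show ?thesis using that \<phi> e1(1) e2(1) closed by (simp add: AutoGroup_mult_apply)
  qed
  \<comment> \<open>The inner maps send \<open>x\<close> to \<open>x y\<close>, then to
    \<open>x (y x) = y\<close>, which \<open>e1\<close> fixes. In turn \<open>y\<close> stays,
    becomes \<open>y x\<close>, and ends as \<open>y (x y) = x\<close>.\<close>
  have swap: "?e2 (?e1 (?g x)) = ?g y"
    using xy g by (simp add: e1 e2 mult S.comm[of "?g y"] S.cancel)
  have "?\<phi>' (?g x) = \<phi> (?g y)"
    using app[OF g[OF xy(1)]] swap e1(3)[OF xy(2)] xy(3) by simp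
  moreover have "?e1 (?e2 (?e1 (?g y))) = ?g x"
    using xy g by (simp add: e1 e2 mult S.comm[of "?g x" "?g y"] S.cancel)
  then have "?\<phi>' (?g y) = \<phi> (?g x)" using xy g by (simp add: app)
  moreover have "?\<phi>' (?g z) = \<phi> (?g z)" if "z \<in> X" "z \<noteq> x" "z \<noteq> y" for z
    using that g by (simp add: app e1 e2)
  ultimately have "?\<phi>' \<in> tame_auts X" by (rule tame[OF a3])
  then show ?thesis
    using \<phi> a1 a2 e1(4) e2(4) by (blast intro: tame_cancel_elementary)
qed

text \<open>Sorting by transpositions: if \<open>x\<close> goes to another generator
  \<open>y\<close>, exchanging the images of \<open>x\<close> and \<open>y\<close> makes
  \<open>y\<close> fixed and lowers the number of moved generators.\<close>

lemma permutation_tame: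
  assumes "finite X" "\<phi> \<in> auto (free_steiner_loop X)"
    and "\<And>x. x \<in> X \<Longrightarrow> \<phi> (free_gen X x) \<in> free_gen X ` X"
  shows "\<phi> \<in> tame_auts X"
  using assms(2,3)
proof (induction "card {x \<in> X. \<phi> (free_gen X x) \<noteq> free_gen X x}" arbitrary: \<phi> rule: less_induct)
  case less
  let ?S = "free_steiner_loop X" let ?A = "AutoGroup ?S" let ?g = "free_gen X"
  interpret A: group ?A by (rule group_AutoGroup[OF steiner_loop_free])
  show ?case
  proof (cases "\<forall>x\<in>X. \<phi> (?g x) = ?g x")
    case True
    have one: "\<one>\<^bsub>?A\<^esub> \<in> auto ?S" using A.one_closed by simp
    have gens: "\<phi> (?g x) = \<one>\<^bsub>?A\<^esub> (?g x)" if "x \<in> X" for x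
      using that True by (simp add: AutoGroup_one free_gen_closed)
    have "\<phi> = \<one>\<^bsub>?A\<^esub>"
    proof (rule extensionalityI)
      show "\<phi> a = \<one>\<^bsub>?A\<^esub> a" if "a \<in> carrier ?S" for a
        by (rule free_hom_eqI[OF steiner_loop_free, of \<phi> X X])
          (use one less.prems(1) gens that in \<open>auto simp: auto_def\<close>)
    qed (use one less.prems(1) in \<open>auto simp: auto_def Bij_def\<close>)
    then show ?thesis by (simp add: tame_auts_def generate.one)
  next
    case False
    then obtain x where x: "x \<in> X" "\<phi> (?g x) \<noteq> ?g x" by auto
    obtain y where y: "y \<in> X" "\<phi> (?g x) = ?g y" using less.prems(2) x(1) by auto
    have "x \<noteq> y" using x y by auto
    have "inj_on \<phi> (carrier ?S)" using less.prems(1) by (auto simp: auto_def Bij_def bij_betw_def)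
    \<comment> \<open>The value \<open>?g y\<close> is already taken at \<open>x\<close>, so
      \<open>y\<close> is moved as well.\<close>
    then have "\<phi> (?g y) \<noteq> \<phi> (?g x)"
      using x y free_gen_closed by (metis inj_onD)
    then have y': "\<phi> (?g y) \<noteq> ?g y" using y by simp
    from less.prems(1) x(1) y(1) \<open>x \<noteq> y\<close> show ?thesis
    proof (rule tame_cancel_transposition)
      fix \<phi>' assume \<phi>': "\<phi>' \<in> auto ?S" "\<phi>' (?g x) = \<phi> (?g y)" "\<phi>' (?g y) = \<phi> (?g x)"
        and other: "\<And>z. \<lbrakk>z \<in> X; z \<noteq> x; z \<noteq> y\<rbrakk> \<Longrightarrow> \<phi>' (?g z) = \<phi> (?g z)"
      have "z \<in> X \<and> \<phi> (?g z) \<noteq> ?g z" if "z \<in> X" "\<phi>' (?g z) \<noteq> ?g z" for z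
        using that x y' other by metis
      moreover have "\<phi>' (?g y) = ?g y" using \<phi>'(3) y(2) by simp
      ultimately have "{z \<in> X. \<phi>' (?g z) \<noteq> ?g z} \<subset> {z \<in> X. \<phi> (?g z) \<noteq> ?g z}"
        using y(1) y' by blast
      then have "card {z \<in> X. \<phi>' (?g z) \<noteq> ?g z} < card {z \<in> X. \<phi> (?g z) \<noteq> ?g z}"
        using assms(1) by (intro psubset_card_mono) auto
      moreover have "\<phi>' (?g z) \<in> ?g ` X" if "z \<in> X" for z
        using that less.prems(2) x(1) y(1) \<phi>'(2,3) other by metis
      ultimately show "\<phi>' \<in> tame_auts X" using less.hyps \<phi>'(1) by blast
    qed
  qed
qed

section \<open>Reduction of an arbitrary automorphism by total length\<close>

theorem theorem7:
  fixes X :: "'a set"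
  assumes "finite X"
  shows "carrier (AutoGroup (free_steiner_loop X)) = tame_auts X"
proof
  let ?S = "free_steiner_loop X" let ?A = "AutoGroup ?S" let ?g = "free_gen X"
  interpret A: group ?A by (rule group_AutoGroup[OF steiner_loop_free])
  show "tame_auts X \<subseteq> carrier ?A"
    unfolding tame_auts_def using elementary_auts_subset by (intro A.generate_incl) simp
  obtain h k where h: "h \<in> hom ?S (words X)" and k: "k \<in> hom (words X) ?S"
    and hg: "\<And>x. x \<in> X \<Longrightarrow> h (?g x) = Gen x" and kg: "\<And>x. x \<in> X \<Longrightarrow> k (Gen x) = ?g x"
    and kh: "\<And>a. a \<in> carrier ?S \<Longrightarrow> k (h a) = a"
    and hk: "\<And>w. w \<in> insert One (red X) \<Longrightarrow> h (k w) = w"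
    by (rule free_iso_words) blast
  have h_closed: "h a \<in> insert One (red X)" if "a \<in> carrier ?S" for a
    using h that by (auto simp: hom_def)
  have k_closed: "k w \<in> carrier ?S" if "w \<in> insert One (red X)" for w
    using k that by (auto simp: hom_def)
  have "\<phi> \<in> tame_auts X" if "\<phi> \<in> auto ?S" for \<phi>
    using that
  proof (induction "\<Sum>x\<in>X. size (h (\<phi> (?g x)))" arbitrary: \<phi> rule: less_induct)
    case less
    \<comment> \<open>This is \<open>\<phi>\<close> transported to reduced words along the
      isomorphism.\<close>
    define \<psi> where "\<psi> w = h (\<phi> (k w))" for w
    have \<phi>: "\<phi> \<in> hom ?S ?S" "bij_betw \<phi> (carrier ?S) (carrier ?S)"
      using less.prems by (auto simp: auto_def Bij_def)
    have \<phi>_closed: "\<phi> a \<in> carrier ?S" if "a \<in> carrier ?S" for a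
      using \<phi>(1) that by (auto simp: hom_def)
    have \<psi>_hom: "\<psi> \<in> hom (words X) (words X)"
      using Group.hom_compose[OF Group.hom_compose[OF k \<phi>(1)] h] by (simp add: comp_def \<psi>_def[abs_def])
    have k_bij: "bij_betw k (insert One (red X)) (carrier ?S)"
      by (rule bij_betw_byWitness[where f' = h]) (use h_closed k_closed hk kh in auto)
    have h_bij: "bij_betw h (carrier ?S) (insert One (red X))"
      by (rule bij_betw_byWitness[where f' = k]) (use h_closed k_closed hk kh in auto)
    have \<psi>_bij: "bij_betw \<psi> (insert One (red X)) (insert One (red X))"
      using bij_betw_trans[OF bij_betw_trans[OF k_bij \<phi>(2)] h_bij] by (simp add: comp_def \<psi>_def[abs_def])
    show ?case
    proof (cases "\<forall>x\<in>X. \<forall>r\<in>red (X - {x}). size (\<psi> (Gen x)) \<le> size (mul (\<psi> (Gen x)) (\<psi> r))")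
      case True
      have preimage: "\<exists>y\<in>X. \<phi> (?g y) = ?g x" if x: "x \<in> X" for x
      proof -
        obtain y where y: "y \<in> X" "\<psi> (Gen y) = Gen x"
          using irreducible_permutes_generators[OF \<psi>_hom \<psi>_bij _ x] True by blast
        then have "k (h (\<phi> (?g y))) = ?g x" using x by (simp add: \<psi>_def kg)
        then show ?thesis using y(1) kh \<phi>_closed free_gen_closed by metis
      qed
      \<comment> \<open>All generators occur among the images of generators; as \<open>X\<close> is
        finite, counting makes the two sets equal.\<close>
      then have sub: "?g ` X \<subseteq> (\<lambda>y. \<phi> (?g y)) ` X" by (metis image_eqI image_subsetI)
      have "card ((\<lambda>y. \<phi> (?g y)) ` X) \<le> card (?g ` X)"
        using card_image_le[OF assms] card_image[OF inj_on_free_gen] by metis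
      then have "?g ` X = (\<lambda>y. \<phi> (?g y)) ` X"
        using sub assms by (intro card_seteq) auto
      then show ?thesis using permutation_tame[OF assms less.prems] by blast
    next
      case False
      then obtain x r where x: "x \<in> X" and r: "r \<in> red (X - {x})"
        and shorter: "size (mul (\<psi> (Gen x)) (\<psi> r)) < size (\<psi> (Gen x))"
        by (meson not_le)
      \<comment> \<open>Since \<open>r\<close> avoids \<open>x\<close>, its value \<open>k r\<close>
        is an admissible multiplier for \<open>x\<close>.\<close>
      have "k ` Gen ` (X - {x}) = ?g ` (X - {x})" using kg by (simp add: image_image)
      with hom_word_mem_subloop_generated[OF k Diff_subset r]
      have v: "k r \<in> subloop_generated ?S (?g ` (X - {x}))" by (simp only:)
      note e = elementary_aut_props[OF x v]
      let ?e = "elementary_aut X x (k r)" let ?\<phi>' = "\<phi> \<otimes>\<^bsub>?A\<^esub> ?e"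
      have vS: "k r \<in> carrier ?S"
        by (rule subsetD[OF subloop_generated_subset[OF steiner_loop_free] v])
          (auto intro: free_gen_closed)
      have app: "?\<phi>' a = \<phi> (?e a)" if "a \<in> carrier ?S" for a
        using less.prems e(1) that by (rule AutoGroup_mult_apply)
      \<comment> \<open>Precomposing with \<open>x -> x (k r)\<close> multiplies the image of
        \<open>x\<close> by \<open>\<phi> (k r)\<close>; in words this is the shortening just
        found.\<close>
      have "?\<phi>' (?g x) = \<phi> (?g x) \<otimes>\<^bsub>?S\<^esub> \<phi> (k r)"
        using \<phi>(1) x vS by (simp add: app e free_gen_closed hom_def)
      then have "h (?\<phi>' (?g x)) = mul (\<psi> (Gen x)) (\<psi> r)"
        using h x vS \<phi>_closed by (simp add: \<psi>_def kg hom_def free_gen_closed)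
      then have lt: "size (h (?\<phi>' (?g x))) < size (h (\<phi> (?g x)))"
        using shorter x by (simp add: \<psi>_def kg)
      have other: "?\<phi>' (?g y) = \<phi> (?g y)" if "y \<in> X" "y \<noteq> x" for y
        using that by (simp add: app e free_gen_closed)
      have "(\<Sum>y\<in>X. size (h (?\<phi>' (?g y)))) < (\<Sum>y\<in>X. size (h (\<phi> (?g y))))"
        using assms
      proof (rule sum_strict_mono_ex1)
        show "\<forall>y\<in>X. size (h (?\<phi>' (?g y))) \<le> size (h (\<phi> (?g y)))"
          using lt other by (metis le_refl less_imp_le)
      qed (use lt x in blast)
      moreover have "?\<phi>' \<in> auto ?S" using A.m_closed less.prems e(1) by simp
      ultimately have "?\<phi>' \<in> tame_auts X" by (rule less.hyps)
      then show ?thesis using tame_cancel_elementary less.prems e(4) by blast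
    qed
  qed
  then show "carrier ?A \<subseteq> tame_auts X" by auto
qed

end
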